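(* Let $d\ge 1$ and let $V,W:\mathbb{R}^d\to(0,\infty)$ be continuous functions such that $\mu=V^{-d}\,dx$ and $\nu=W^{-d}\,dx$ are probability measures on $\mathbb{R}^d$. Assume that there exist $p,q>1$ and $L,M>0$ such that $$V(x)\le L(1+|x|^q)\quad\text{and}\quad W(y)\ge M(1+|y|^p)\qquad\text{for all }x,y\in\mathbb{R}^d.$$ Let $T$ be the Brenier map from $\mu$ onto $\nu$. Then there is a constant $C>0$, depending only on $p,q,d,L,M$ and on the behaviour of $V$ in a fixed bounded region, such that $$|T(x)|\le C(1+|x|)^{\frac{q-1}{p-1}}\qquad\text{for all }x\in\mathbb{R}^d.$$
   Context: $|\cdot|$ is the Euclidean norm. Brenier map: for $\mu$ absolutely continuous with respect to Lebesgue measure and $\nu$ any Borel probability measure on $\mathbb{R}^d$, there is a convex function $\phi$ such that $T=\nabla\phi$ pushes $\mu$ forward to $\nu$, and $T$ is unique of this form up to $\mu$-null sets (Brenier–McCann theorem). This $T$ is the Brenier map. Pointwise statements about $T(x)$ are understood at the points $x$ where $\phi$ is differentiable (in particular they hold for $\mu$-almost every $x$). *)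

theory Defs
  imports "HOL-Analysis.Analysis" "HOL-Probability.Probability"
begin

text \<open>The measure \<open>V\<^sup>-\<^sup>d dx\<close> on \<open>\<real>\<^sup>d\<close>, where \<open>d = CARD('n)\<close>.\<close>

definition inverse_power_measure :: "(real ^ 'n \<Rightarrow> real) \<Rightarrow> (real ^ 'n) measure" where
  "inverse_power_measure V = density lborel (\<lambda>x. ennreal (1 / V x ^ CARD('n)))"

text \<open>
  A convex function \<open>\<real>\<^sup>d \<rightarrow> (-\<infinity>, \<infinity>]\<close> is encoded by a convex set \<open>S\<close> (the set where it is finite)
  together with a real-valued function \<open>\<phi>\<close> that is convex on \<open>S\<close>; the values of \<open>\<phi>\<close> outside
  \<open>S\<close> are irrelevant.  An everywhere finite convex function is the case \<open>S = UNIV\<close>.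
  Differentiability is meant in the interior of \<open>S\<close>, so that it does not see those values.
\<close>

definition differentiability_set ::
    "'a::euclidean_space set \<Rightarrow> ('a \<Rightarrow> real) \<Rightarrow> 'a set" where
  "differentiability_set S \<phi> = {x \<in> interior S. \<phi> differentiable (at x)}"

text \<open>
  \<open>T\<close> is a Brenier map from \<open>\<mu>\<close> to \<open>\<nu>\<close> with convex potential \<open>\<phi>\<close> on \<open>S\<close>: the gradient of \<open>\<phi>\<close> is
  defined \<open>\<mu>\<close>-almost everywhere, \<open>T\<close> equals it at every point where it exists, and \<open>T\<close> pushes
  \<open>\<mu>\<close> forward to \<open>\<nu>\<close>.  The values of \<open>T\<close> at the remaining points (a \<open>\<mu>\<close>-null set) are arbitrary.
\<close>

definition brenier_map ::
    "'a::euclidean_space measure \<Rightarrow> 'a measure \<Rightarrow> 'a set \<Rightarrow> ('a \<Rightarrow> real) \<Rightarrow> ('a \<Rightarrow> 'a) \<Rightarrow> bool" where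
  "brenier_map \<mu> \<nu> S \<phi> T \<longleftrightarrow>
     convex_on S \<phi> \<and>
     (AE x in \<mu>. x \<in> differentiability_set S \<phi>) \<and>
     (\<forall>x\<in>differentiability_set S \<phi>. GDERIV \<phi> x :> T x) \<and>
     T \<in> measurable \<mu> borel \<and>
     distr \<mu> borel T = \<nu>"

end

theory Submission imports Defs begin

text \<open>
  Put \<open>y\<^sub>0 = T x\<^sub>0\<close> and \<open>\<rho> = 1 + |x\<^sub>0|\<close>. Since \<open>T\<close> is a gradient of a convex function it is monotone,
  which forces \<open>|T x| \<ge> |y\<^sub>0| / 3\<close> for every \<open>x\<close> in the ball of radius \<open>\<rho>\<close> about
  \<open>x\<^sub>0 + 2 \<rho> y\<^sub>0 / |y\<^sub>0|\<close>. The \<open>\<mu>\<close>-mass of this ball is at least of order \<open>\<rho>\<^bsup>d(1-q)\<^esup>\<close>, and the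
  \<open>\<nu>\<close>-mass of \<open>{|y| \<ge> |y\<^sub>0| / 3}\<close> is at most of order \<open>|y\<^sub>0|\<^bsup>d(1-p)\<^esup>\<close>; comparing the two
  gives the bound.
\<close>

section \<open>Monotonicity of gradients of convex functions\<close>

text \<open>Restrict \<open>\<phi>\<close> to the segment from \<open>x\<close> to \<open>y\<close>.
  By convexity its difference quotients at \<open>x\<close> are at most
  \<open>\<phi> y - \<phi> x\<close> for \<open>0 < t < 1\<close>, and they tend to
  \<open>g \<bullet> (y - x)\<close> as \<open>t\<close> decreases to 0. The limit is one-sided
  because the convexity estimate needs points between \<open>x\<close> and \<open>y\<close>.\<close>

lemma convex_on_GDERIV_above_tangent:
  fixes \<phi> :: "'a::euclidean_space \<Rightarrow> real"
  assumes cvx: "convex_on S \<phi>" and "x \<in> S" "y \<in> S" and deriv: "GDERIV \<phi> x :> g"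
  shows "\<phi> x + g \<bullet> (y - x) \<le> \<phi> y"
proof -
  define h where "h t = \<phi> (x + t *\<^sub>R (y - x))" for t :: real
  have line: "((\<lambda>t::real. x + t *\<^sub>R (y - x)) has_derivative (\<lambda>t. t *\<^sub>R (y - x))) (at 0)"
    by (auto intro!: derivative_eq_intros)
  have "(\<phi> has_derivative (\<lambda>v. v \<bullet> g)) (at (x + 0 *\<^sub>R (y - x)))"
    using deriv by (simp add: gderiv_def)
  from has_derivative_compose[OF line this]
  have "(h has_derivative (\<lambda>t. t * (g \<bullet> (y - x)))) (at 0)"
    unfolding h_def by (simp add: inner_commute)
  then have "(h has_real_derivative (g \<bullet> (y - x))) (at 0)"
    by (simp add: has_field_derivative_def mult_commute_abs)
  then have "((\<lambda>t. (h t - h 0) / t) \<longlongrightarrow> g \<bullet> (y - x)) (at_right 0)"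
    by (simp add: has_field_derivative_iff filterlim_at_split)
  moreover have "\<forall>\<^sub>F t in at_right 0. (h t - h 0) / t \<le> \<phi> y - \<phi> x"
    unfolding eventually_at_right_field
  proof (intro exI[of _ 1] conjI allI impI)
    fix t :: real assume "0 < t" "t < 1"
    then have "\<phi> ((1 - t) *\<^sub>R x + t *\<^sub>R y) \<le> (1 - t) * \<phi> x + t * \<phi> y"
      using convex_onD[OF cvx, of t x y] assms(2,3) by simp
    then have "h t - h 0 \<le> t * (\<phi> y - \<phi> x)"
      by (simp add: h_def algebra_simps)
    then show "(h t - h 0) / t \<le> \<phi> y - \<phi> x"
      using \<open>0 < t\<close> by (simp add: field_simps)
  qed simp
  ultimately have "g \<bullet> (y - x) \<le> \<phi> y - \<phi> x"
    by (intro tendsto_upperbound) auto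
  then show ?thesis by simp
qed

lemma convex_on_GDERIV_mono:
  fixes \<phi> :: "'a::euclidean_space \<Rightarrow> real"
  assumes "convex_on S \<phi>" "x \<in> S" "y \<in> S" "GDERIV \<phi> x :> g" "GDERIV \<phi> y :> h"
  shows "(h - g) \<bullet> (y - x) \<ge> 0"
  using convex_on_GDERIV_above_tangent[OF assms(1-4)]
    convex_on_GDERIV_above_tangent[OF assms(1,3,2,5)]
  by (simp add: inner_diff_left inner_diff_right)

text \<open>The ball has its center at distance \<open>2 * \<rho>\<close> from \<open>x0\<close> in
  the direction of \<open>y0\<close>, so \<open>x - x0\<close> has a component of at least
  \<open>\<rho>\<close> in that direction and length at most \<open>3 * \<rho>\<close>. Monotonicity
  turns the first fact into \<open>norm y0 * \<rho> \<le> y \<bullet> (x - x0)\<close>.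
  Cauchy-Schwarz and the second fact then give the ratio 1/3.\<close>

lemma monotone_norm_lower_bound:
  fixes x x0 y y0 :: "'a::real_inner"
  assumes mono: "(y - y0) \<bullet> (x - x0) \<ge> 0" and "\<rho> > 0" "y0 \<noteq> 0"
    and x: "x \<in> ball (x0 + (2 * \<rho> / norm y0) *\<^sub>R y0) \<rho>"
  shows "norm y0 / 3 \<le> norm y"
proof -
  define w where "w = x - (x0 + (2 * \<rho> / norm y0) *\<^sub>R y0)"
  have w: "norm w < \<rho>" using x by (simp add: w_def dist_norm norm_minus_commute)
  have xw: "x - x0 = (2 * \<rho> / norm y0) *\<^sub>R y0 + w" by (simp add: w_def)
  have "y0 \<bullet> w \<ge> - (norm y0 * norm w)" using Cauchy_Schwarz_ineq2[of y0 w] by linarith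
  moreover have "norm y0 * norm w \<le> norm y0 * \<rho>" using w by (intro mult_left_mono) auto
  moreover have "y0 \<bullet> (x - x0) = 2 * \<rho> * norm y0 + y0 \<bullet> w"
    using \<open>y0 \<noteq> 0\<close> by (simp add: xw inner_add_right power2_norm_eq_inner[symmetric] power2_eq_square)
  ultimately have "norm y0 * \<rho> \<le> y0 \<bullet> (x - x0)" by (simp add: algebra_simps)
  also have "\<dots> \<le> y \<bullet> (x - x0)" using mono by (simp add: inner_diff_left)
  also have "\<dots> \<le> norm y * norm (x - x0)" by (rule norm_cauchy_schwarz)
  also have "\<dots> \<le> norm y * (3 * \<rho>)"
  proof (intro mult_left_mono)
    have "norm (x - x0) \<le> norm ((2 * \<rho> / norm y0) *\<^sub>R y0) + norm w"
      unfolding xw by (rule norm_triangle_ineq)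
    then show "norm (x - x0) \<le> 3 * \<rho>" using w \<open>y0 \<noteq> 0\<close> \<open>\<rho> > 0\<close> by simp
  qed simp
  finally show ?thesis using \<open>\<rho> > 0\<close> by (simp add: field_simps)
qed

section \<open>Bounds for the mass of balls and of tails\<close>

lemma emeasure_density_ge_const:
  assumes [measurable]: "f \<in> borel_measurable M" "A \<in> sets M"
    and "\<And>x. x \<in> A \<Longrightarrow> c \<le> f x"
  shows "c * emeasure M A \<le> emeasure (density M f) A"
proof -
  have "c * emeasure M A = (\<integral>\<^sup>+x. c * indicator A x \<partial>M)"
    by (simp add: nn_integral_cmult_indicator)
  also have "\<dots> \<le> (\<integral>\<^sup>+x. f x * indicator A x \<partial>M)"
    by (intro nn_integral_mono) (auto split: split_indicator simp: assms)
  finally show ?thesis by (simp add: emeasure_density)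
qed

lemma emeasure_density_le_const:
  assumes [measurable]: "f \<in> borel_measurable M" "A \<in> sets M"
    and "\<And>x. x \<in> A \<Longrightarrow> f x \<le> c"
  shows "emeasure (density M f) A \<le> c * emeasure M A"
proof -
  have "(\<integral>\<^sup>+x. f x * indicator A x \<partial>M) \<le> (\<integral>\<^sup>+x. c * indicator A x \<partial>M)"
    by (intro nn_integral_mono) (auto split: split_indicator simp: assms)
  then show ?thesis by (simp add: emeasure_density nn_integral_cmult_indicator)
qed

text \<open>The shell containing \<open>y\<close> is found from the least \<open>j\<close> with
  \<open>norm y < 2 ^ j * r\<close>. This \<open>j\<close> is positive because
  \<open>r \<le> norm y\<close>, so its predecessor indexes the shell.\<close>

lemma norm_ge_subset_dyadic_shells:
  fixes r :: real
  assumes "r > 0"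
  shows "{y::'a::real_normed_vector. r \<le> norm y} \<subseteq> (\<Union>k. ball 0 (2 ^ Suc k * r) - ball 0 (2 ^ k * r))"
proof
  fix y :: 'a assume "y \<in> {y. r \<le> norm y}"
  then have y: "r \<le> norm y" by simp
  obtain n where "norm y / r < 2 ^ n" using real_arch_pow[of 2 "norm y / r"] by auto
  then have ex: "norm y < 2 ^ n * r" using assms by (simp add: field_simps)
  define j where "j = (LEAST j. norm y < 2 ^ j * r)"
  have j: "norm y < 2 ^ j * r" unfolding j_def by (rule LeastI[of _ n]) (rule ex)
  with y have "j \<noteq> 0" by (intro notI) simp
  then obtain k where k: "j = Suc k" by (cases j) auto
  have "\<not> norm y < 2 ^ k * r"
    using not_less_Least[of k "\<lambda>j. norm y < 2 ^ j * r"] k by (simp add: j_def)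
  with j k show "y \<in> (\<Union>k. ball 0 (2 ^ Suc k * r) - ball 0 (2 ^ k * r))" by auto
qed

text \<open>On the \<open>k\<close>-th dyadic shell the density is at most
  \<open>(M * (2 ^ k * r) powr p)\<close> to the power -d, and the volume is at most that of the
  outer ball. The product decays geometrically in \<open>k\<close> since \<open>p > 1\<close>. The
  bound keeps the dependence on \<open>r\<close> inside a d-th power, so that a d-th root can be
  taken when it is compared with the mass of a ball.\<close>

lemma emeasure_tail_le:
  fixes W :: "'a::euclidean_space \<Rightarrow> real"
  assumes W[measurable]: "W \<in> borel_measurable borel"
    and bound: "\<And>y. M * norm y powr p \<le> W y"
    and "p > 1" "M > 0" "r > 0"
  shows "emeasure (density lborel (\<lambda>x. ennreal (1 / W x ^ DIM('a)))) {y. r \<le> norm y}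
    \<le> ennreal (unit_ball_vol (DIM('a)) * (1 / (1 - 2 powr (1 - p))) * (2 * r / (M * r powr p)) ^ DIM('a))"
    (is "emeasure ?\<nu> _ \<le> ennreal (?\<omega> * ?K * ?Y ^ ?d)")
proof -
  define A :: "nat \<Rightarrow> 'a set" where "A k = ball 0 (2 ^ Suc k * r) - ball 0 (2 ^ k * r)" for k
  define \<theta> :: real where "\<theta> = 2 powr (1 - p)"
  have \<theta>: "0 < \<theta>" "\<theta> < 1" using \<open>p > 1\<close> by (auto simp: \<theta>_def powr_less_one)
  have Y: "?Y > 0" using assms by simp
  have shell: "emeasure ?\<nu> (A k) \<le> ennreal (?\<omega> * ?Y ^ ?d * \<theta> ^ k)" for k
  proof -
    define m where "m = M * (2 ^ k * r) powr p"
    have m: "m > 0" using assms by (simp add: m_def)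
    have "emeasure ?\<nu> (A k) \<le> ennreal (1 / m ^ ?d) * emeasure lborel (A k)"
    proof (rule emeasure_density_le_const)
      fix y assume "y \<in> A k"
      then have "2 ^ k * r \<le> norm y" by (simp add: A_def)
      then have "m \<le> M * norm y powr p"
        unfolding m_def using assms by (intro mult_left_mono powr_mono2) auto
      with bound[of y] have "m \<le> W y" by linarith
      then have "m ^ ?d \<le> W y ^ ?d" using m by (intro power_mono) auto
      then show "ennreal (1 / W y ^ ?d) \<le> ennreal (1 / m ^ ?d)"
        using m by (intro ennreal_leI divide_left_mono mult_pos_pos)
          (auto intro: less_le_trans[of 0 "m ^ ?d"])
    qed (auto simp: A_def)
    also have "\<dots> \<le> ennreal (1 / m ^ ?d) * emeasure lborel (ball (0::'a) (2 ^ Suc k * r))"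
      by (intro mult_left_mono emeasure_mono) (auto simp: A_def)
    also have "\<dots> = ennreal (1 / m ^ ?d * (?\<omega> * (2 ^ Suc k * r) ^ ?d))"
      using assms m by (subst emeasure_ball) (auto simp: ennreal_mult[symmetric] unit_ball_vol_nonneg)
    also have "1 / m ^ ?d * (?\<omega> * (2 ^ Suc k * r) ^ ?d) = ?\<omega> * (2 ^ Suc k * r / m) ^ ?d"
      by (simp add: power_divide)
    \<comment> \<open>The radius grows like \<open>2 ^ k\<close> and \<open>m\<close> like
      \<open>2 powr (k * p)\<close>, so each further shell contributes a factor
      \<open>2 powr (1 - p)\<close>, which is \<open>\<theta>\<close>.\<close>
    also have "2 ^ Suc k * r / m = ?Y * \<theta> ^ k"
    proof -
      have "(2 ^ k :: real) = 2 powr k" by (simp add: powr_realpow)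
      moreover have "\<theta> ^ k = 2 powr (k * (1 - p))"
        by (simp add: \<theta>_def powr_powr powr_realpow[symmetric] mult.commute)
      moreover have "2 powr (k * (1 - p)) = 2 powr k / (2::real) powr (k * p)"
        by (simp add: powr_diff right_diff_distrib)
      ultimately show ?thesis using assms by (simp add: m_def powr_mult powr_powr mult_ac)
    qed
    \<comment> \<open>Replacing \<open>(\<theta> ^ k) ^ d\<close> by the larger
      \<open>\<theta> ^ k\<close> makes the sum of the series, \<open>1 / (1 - \<theta>)\<close>,
      independent of the dimension.\<close>
    also have "ennreal (?\<omega> * (?Y * \<theta> ^ k) ^ ?d) \<le> ennreal (?\<omega> * ?Y ^ ?d * \<theta> ^ k)"
    proof (rule ennreal_leI)
      have "(\<theta> ^ k) ^ ?d \<le> (\<theta> ^ k) ^ 1"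
        using \<theta> by (intro power_decreasing) (auto simp: power_le_one Suc_leI)
      then show "?\<omega> * (?Y * \<theta> ^ k) ^ ?d \<le> ?\<omega> * ?Y ^ ?d * \<theta> ^ k"
        unfolding power_mult_distrib mult.assoc using Y
        by (intro mult_left_mono) (auto simp: unit_ball_vol_nonneg)
    qed
    finally show ?thesis .
  qed
  have meas: "range A \<subseteq> sets ?\<nu>" by (auto simp: A_def)
  have "emeasure ?\<nu> {y. r \<le> norm y} \<le> emeasure ?\<nu> (\<Union>k. A k)"
    using norm_ge_subset_dyadic_shells[OF \<open>r > 0\<close>, where 'a='a] meas
    by (intro emeasure_mono) (auto simp: A_def)
  also have "\<dots> \<le> (\<Sum>k. emeasure ?\<nu> (A k))" by (rule emeasure_subadditive_countably[OF meas])
  also have "\<dots> \<le> (\<Sum>k. ennreal (?\<omega> * ?Y ^ ?d * \<theta> ^ k))"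
    by (intro suminf_le shell) auto
  also have "\<dots> = ennreal (?\<omega> * ?Y ^ ?d * (1 / (1 - \<theta>)))"
  proof (rule suminf_ennreal_eq)
    show "0 \<le> ?\<omega> * ?Y ^ ?d * \<theta> ^ k" for k
      using Y \<theta> by (intro mult_nonneg_nonneg) (auto simp: unit_ball_vol_nonneg)
    show "(\<lambda>k. ?\<omega> * ?Y ^ ?d * \<theta> ^ k) sums (?\<omega> * ?Y ^ ?d * (1 / (1 - \<theta>)))"
      using \<theta> by (intro sums_mult geometric_sums) auto
  qed
  finally show ?thesis by (simp add: \<theta>_def mult_ac)
qed

text \<open>Since \<open>4 * \<rho> \<ge> 1\<close>, both summands in
  \<open>1 + norm x powr q\<close> are at most \<open>(4 * \<rho>) powr q\<close> on the ball. Hence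
  \<open>V \<le> 2 * L * (4 * \<rho>) powr q\<close> there, and the density is bounded below by a
  constant.\<close>

lemma emeasure_ball_ge:
  fixes V :: "'a::euclidean_space \<Rightarrow> real"
  assumes V[measurable]: "V \<in> borel_measurable borel" and Vpos: "\<And>x. V x > 0"
    and bound: "\<And>x. V x \<le> L * (1 + norm x powr q)"
    and "q > 0" "L > 0" "\<rho> \<ge> 1"
    and sub: "\<And>x. x \<in> ball z \<rho> \<Longrightarrow> norm x \<le> 4 * \<rho>"
  shows "ennreal (unit_ball_vol (DIM('a)) * (\<rho> / (2 * L * (4 * \<rho>) powr q)) ^ DIM('a))
    \<le> emeasure (density lborel (\<lambda>x. ennreal (1 / V x ^ DIM('a)))) (ball z \<rho>)"
    (is "ennreal (?\<omega> * ?X ^ ?d) \<le> emeasure ?\<mu> _")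
proof -
  define m where "m = 2 * L * (4 * \<rho>) powr q"
  have m: "m > 0" using assms by (simp add: m_def)
  have "?\<omega> * ?X ^ ?d = 1 / m ^ ?d * (?\<omega> * \<rho> ^ ?d)"
    by (simp add: m_def power_divide)
  also have "ennreal \<dots> = ennreal (1 / m ^ ?d) * emeasure lborel (ball z \<rho>)"
    using assms m by (subst emeasure_ball) (auto simp: ennreal_mult[symmetric] unit_ball_vol_nonneg)
  also have "\<dots> \<le> emeasure ?\<mu> (ball z \<rho>)"
  proof (rule emeasure_density_ge_const)
    fix x assume "x \<in> ball z \<rho>"
    then have "norm x powr q \<le> (4 * \<rho>) powr q"
      using sub \<open>q > 0\<close> by (intro powr_mono2) auto
    moreover have "1 \<le> (4 * \<rho>) powr q" using assms by (intro ge_one_powr_ge_zero) auto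
    ultimately have "L * (1 + norm x powr q) \<le> L * (2 * (4 * \<rho>) powr q)"
      using \<open>L > 0\<close> by (intro mult_left_mono) auto
    with bound[of x] have "V x \<le> m" by (simp add: m_def)
    then have "V x ^ ?d \<le> m ^ ?d" using Vpos[of x] by (intro power_mono) auto
    then show "ennreal (1 / m ^ ?d) \<le> ennreal (1 / V x ^ ?d)"
      using Vpos[of x] m by (intro ennreal_leI divide_left_mono mult_pos_pos) auto
  qed auto
  finally show ?thesis .
qed

section \<open>Comparison of masses and the growth bound\<close>

text \<open>Monotonicity of \<open>T\<close> is available only at points of differentiability, so
  the ball lies in the preimage of the tail up to a \<open>\<mu>\<close>-null set. This suffices,
  and the push-forward identity converts the mass of the preimage into
  \<open>\<nu>\<close>-mass.\<close>

lemma brenier_map_emeasure_ball_le: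
  fixes T :: "'a::euclidean_space \<Rightarrow> 'a"
  assumes br: "brenier_map \<mu> \<nu> S \<phi> T" and sets: "sets \<mu> = sets borel"
    and x0: "x0 \<in> differentiability_set S \<phi>" and "\<rho> > 0" "T x0 \<noteq> 0"
  shows "emeasure \<mu> (ball (x0 + (2 * \<rho> / norm (T x0)) *\<^sub>R T x0) \<rho>)
    \<le> emeasure \<nu> {y. norm (T x0) / 3 \<le> norm y}"
proof -
  let ?D = "differentiability_set S \<phi>"
  have cvx: "convex_on S \<phi>" and AE: "AE x in \<mu>. x \<in> ?D"
    and grad: "\<And>x. x \<in> ?D \<Longrightarrow> GDERIV \<phi> x :> T x"
    and T[measurable]: "T \<in> measurable \<mu> borel" and push: "distr \<mu> borel T = \<nu>"
    using br by (auto simp: brenier_map_def)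
  have DS: "x \<in> S" if "x \<in> ?D" for x
    using that interior_subset by (auto simp: differentiability_set_def)
  have B: "{y::'a. norm (T x0) / 3 \<le> norm y} \<in> sets borel" by measurable
  have space: "space \<mu> = UNIV" using sets_eq_imp_space_eq[OF sets] by simp
  have "emeasure \<mu> (ball (x0 + (2 * \<rho> / norm (T x0)) *\<^sub>R T x0) \<rho>)
      \<le> emeasure \<mu> (T -` {y. norm (T x0) / 3 \<le> norm y} \<inter> space \<mu>)"
  proof (rule emeasure_mono_AE)
    show "AE x in \<mu>. x \<in> ball (x0 + (2 * \<rho> / norm (T x0)) *\<^sub>R T x0) \<rho> \<longrightarrow>
        x \<in> T -` {y. norm (T x0) / 3 \<le> norm y} \<inter> space \<mu>"
      using AE
    proof eventually_elim
      case (elim x)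
      have "(T x - T x0) \<bullet> (x - x0) \<ge> 0"
        using convex_on_GDERIV_mono[OF cvx DS[OF x0] DS[OF elim] grad[OF x0] grad[OF elim]] .
      from monotone_norm_lower_bound[OF this \<open>\<rho> > 0\<close> \<open>T x0 \<noteq> 0\<close>]
      show ?case by (simp add: space)
    qed
    show "T -` {y. norm (T x0) / 3 \<le> norm y} \<inter> space \<mu> \<in> sets \<mu>"
      using T B by (rule measurable_sets)
  qed
  also have "\<dots> = emeasure \<nu> {y. norm (T x0) / 3 \<le> norm y}"
    unfolding push[symmetric] using T B by (rule emeasure_distr[symmetric])
  finally show ?thesis .
qed

text \<open>Both masses are a multiple of a d-th power, of \<open>X\<close> for the ball and of
  \<open>Y\<close> for the tail. After the d-th root, \<open>X \<le> K * Y\<close> relates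
  \<open>\<rho> powr (1 - q)\<close> to \<open>r powr (1 - p)\<close>, and solving for
  \<open>r\<close> gives the exponent. The leading factor 3 undoes
  \<open>r = norm (T x0) / 3\<close>.\<close>

lemma brenier_map_growth:
  fixes V W :: "'a::euclidean_space \<Rightarrow> real" and T :: "'a \<Rightarrow> 'a"
  assumes "p > 1" "q > 1" "L > 0" "M > 0"
    and V: "V \<in> borel_measurable borel" "\<And>x. V x > 0" "\<And>x. V x \<le> L * (1 + norm x powr q)"
    and W: "W \<in> borel_measurable borel" "\<And>y. M * norm y powr p \<le> W y"
    and br: "brenier_map (density lborel (\<lambda>x. ennreal (1 / V x ^ DIM('a))))
      (density lborel (\<lambda>x. ennreal (1 / W x ^ DIM('a)))) S \<phi> T"
    and x0: "x0 \<in> differentiability_set S \<phi>"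
  shows "norm (T x0) \<le> 3 * (4 * L * 4 powr q / (M * (1 - 2 powr (1 - p)))) powr (1 / (p - 1))
    * (1 + norm x0) powr ((q - 1) / (p - 1))"
proof (cases "T x0 = 0")
  case False
  define \<rho> where "\<rho> = 1 + norm x0"
  define r where "r = norm (T x0) / 3"
  define \<omega> where "\<omega> = unit_ball_vol (DIM('a))"
  define K where "K = 1 / (1 - 2 powr (1 - p))"
  define X where "X = \<rho> / (2 * L * (4 * \<rho>) powr q)"
  define Y where "Y = 2 * r / (M * r powr p)"
  define z where "z = x0 + (2 * \<rho> / norm (T x0)) *\<^sub>R T x0"
  have \<rho>: "\<rho> \<ge> 1" and r: "r > 0" using False by (auto simp: \<rho>_def r_def)
  have "2 powr (1 - p) < 1" using \<open>p > 1\<close> by (simp add: powr_less_one)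
  then have K: "K \<ge> 1" by (simp add: K_def field_simps)
  have \<omega>: "\<omega> > 0" by (simp add: \<omega>_def)
  have XY: "X > 0" "Y > 0" using assms(3,4) \<rho> r by (auto simp: X_def Y_def)
  \<comment> \<open>The 4 adds up \<open>norm x0 \<le> \<rho>\<close>, the shift by
    \<open>2 * \<rho>\<close> and the radius \<open>\<rho>\<close>.\<close>
  have ball: "norm x \<le> 4 * \<rho>" if "x \<in> ball z \<rho>" for x
  proof -
    have "norm x \<le> norm (x - z) + norm z" by norm
    also have "norm z \<le> norm x0 + 2 * \<rho>"
      unfolding z_def using norm_triangle_ineq[of x0 "(2 * \<rho> / norm (T x0)) *\<^sub>R T x0"] False \<rho> by simp
    finally show ?thesis using that by (simp add: \<rho>_def dist_norm norm_minus_commute)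
  qed
  have "ennreal (\<omega> * X ^ DIM('a)) \<le> emeasure (density lborel (\<lambda>x. ennreal (1 / V x ^ DIM('a)))) (ball z \<rho>)"
    unfolding \<omega>_def X_def using assms(2,3) \<rho> ball by (intro emeasure_ball_ge V) auto
  also have "\<dots> \<le> emeasure (density lborel (\<lambda>x. ennreal (1 / W x ^ DIM('a)))) {y. r \<le> norm y}"
    unfolding z_def r_def using \<rho> False by (intro brenier_map_emeasure_ball_le[OF br _ x0]) auto
  also have "\<dots> \<le> ennreal (\<omega> * K * Y ^ DIM('a))"
    unfolding \<omega>_def K_def Y_def by (intro emeasure_tail_le W assms r)
  finally have "\<omega> * X ^ DIM('a) \<le> \<omega> * K * Y ^ DIM('a)"
    using \<omega> K XY by (subst (asm) ennreal_le_iff) auto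
  then have "X ^ DIM('a) \<le> K * Y ^ DIM('a)" using \<omega> by (simp add: mult.assoc)
  \<comment> \<open>As \<open>K \<ge> 1\<close>, it can be absorbed into the d-th power, so no d-th
    root of \<open>K\<close> appears in the constant.\<close>
  also have "\<dots> \<le> K ^ DIM('a) * Y ^ DIM('a)"
    using K XY by (intro mult_right_mono self_le_power) auto
  finally have "X ^ DIM('a) \<le> (K * Y) ^ DIM('a)" by (simp add: power_mult_distrib)
  then have "X \<le> K * Y"
    using K XY by (subst (asm) power_mono_iff) auto
  moreover have "X = 1 / (2 * L * 4 powr q * \<rho> powr (q - 1))"
    using \<rho> by (simp add: X_def powr_mult powr_diff)
  moreover have "Y = 2 / (M * r powr (p - 1))"
    using r by (simp add: Y_def powr_diff)
  ultimately have "r powr (p - 1) \<le> 4 * L * 4 powr q / M * K * \<rho> powr (q - 1)"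
    using assms(3,4) \<rho> r by (simp add: field_simps)
  then have "(r powr (p - 1)) powr (1 / (p - 1))
      \<le> (4 * L * 4 powr q / M * K * \<rho> powr (q - 1)) powr (1 / (p - 1))"
    using \<open>p > 1\<close> by (intro powr_mono2) auto
  then have "r \<le> (4 * L * 4 powr q / M * K) powr (1 / (p - 1)) * \<rho> powr ((q - 1) / (p - 1))"
    using assms(1,3,4) K r by (subst (asm) powr_mult) (auto simp: powr_powr)
  then show ?thesis by (simp add: r_def K_def \<rho>_def)
qed simp

theorem theorem4p4:
  "\<exists>R>0. \<exists>C :: real \<Rightarrow> real \<Rightarrow> real \<Rightarrow> real \<Rightarrow> (real ^ 'n \<Rightarrow> real) \<Rightarrow> real.
    \<forall>(p::real) (q::real) (L::real) (M::real)
      (V :: real ^ 'n \<Rightarrow> real) (W :: real ^ 'n \<Rightarrow> real)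
      (S :: (real ^ 'n) set) (\<phi> :: real ^ 'n \<Rightarrow> real) (T :: real ^ 'n \<Rightarrow> real ^ 'n).
      p > 1 \<and> q > 1 \<and> L > 0 \<and> M > 0 \<and>
      continuous_on UNIV V \<and> (\<forall>x. V x > 0) \<and>
      continuous_on UNIV W \<and> (\<forall>y. W y > 0) \<and>
      prob_space (inverse_power_measure V) \<and>
      prob_space (inverse_power_measure W) \<and>
      (\<forall>x. V x \<le> L * (1 + norm x powr q)) \<and>
      (\<forall>y. W y \<ge> M * (1 + norm y powr p)) \<and>
      brenier_map (inverse_power_measure V) (inverse_power_measure W) S \<phi> T
      \<longrightarrow>
      C p q L M (restrict V (cball 0 R)) > 0 \<and>
      (\<forall>x\<in>differentiability_set S \<phi>.
         norm (T x) \<le> C p q L M (restrict V (cball 0 R)) * (1 + norm x) powr ((q - 1) / (p - 1)))"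
proof -
  define C :: "real \<Rightarrow> real \<Rightarrow> real \<Rightarrow> real \<Rightarrow> (real ^ 'n \<Rightarrow> real) \<Rightarrow> real" where
    "C p q L M U = 3 * (4 * L * 4 powr q / (M * (1 - 2 powr (1 - p)))) powr (1 / (p - 1))" for p q L M U
  show ?thesis
  proof (intro exI[of _ 1] exI[of _ C] conjI allI impI ballI; (elim conjE)?)
    fix p q L M :: real and V :: "real ^ 'n \<Rightarrow> real"
    assume "p > 1" "q > 1" "L > 0" "M > 0"
    moreover from \<open>p > 1\<close> have "2 powr (1 - p) < 1" by (simp add: powr_less_one)
    ultimately show "C p q L M (restrict V (cball 0 1)) > 0"
      by (simp add: C_def)
  next
    fix p q L M :: real and V W \<phi> :: "real ^ 'n \<Rightarrow> real" and S :: "(real ^ 'n) set"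
      and T :: "real ^ 'n \<Rightarrow> real ^ 'n" and x
    assume "p > 1" "q > 1" "L > 0" "M > 0" and V: "continuous_on UNIV V" "\<forall>x. V x > 0"
      and W: "continuous_on UNIV W"
      and Vle: "\<forall>x. V x \<le> L * (1 + norm x powr q)" and Wge: "\<forall>y. M * (1 + norm y powr p) \<le> W y"
      and br: "brenier_map (inverse_power_measure V) (inverse_power_measure W) S \<phi> T"
      and x: "x \<in> differentiability_set S \<phi>"
    \<comment> \<open>The homogeneous form of the lower bound is the one that scales exactly over
      dyadic shells.\<close>
    have "M * norm y powr p \<le> W y" for y
      using Wge[rule_format, of y] \<open>M > 0\<close> by (simp add: distrib_left)
    then show "norm (T x) \<le> C p q L M (restrict V (cball 0 1)) * (1 + norm x) powr ((q - 1) / (p - 1))"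
      unfolding C_def using \<open>p > 1\<close> \<open>q > 1\<close> \<open>L > 0\<close> \<open>M > 0\<close> V W Vle br x
      by (intro brenier_map_growth[where V = V and W = W and S = S and \<phi> = \<phi>])
        (auto simp: inverse_power_measure_def intro: borel_measurable_continuous_onI)
  qed simp
qed

end
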